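(* Let $(G,s_G,t_G)$ and $(N,s_N,t_N)$ be two cat$^1$-groups with operations in $\mathsf{C}$. Then $(N,s_N,t_N)$ is a normal subcat$^1$-group with operations of $(G,s_G,t_G)$ if and only if it is the kernel of some morphism $f\colon(G,s_G,t_G)\to(H,s_H,t_H)$ of cat$^1$-groups with operations.
   Context: Groups with operations. $\mathsf{C}$ is a fixed category of groups with operations: its objects are the algebras with a set $\Omega$ of operations satisfying a set $\mathsf{E}$ of identities, where $\mathsf{E}$ includes the group laws and, with $\Omega_i$ the set of $i$-ary operations: (a) $\Omega=\Omega_0\cup\Omega_1\cup\Omega_2$; (b) the group operations $0,-,+$ (written additively, $+$ not necessarily commutative) belong to $\Omega_0,\Omega_1,\Omega_2$ respectively, $\Omega_0=\{0\}$, and with $\Omega_1'=\Omega_1\setminus\{-\}$, $\Omega_2'=\Omega_2\setminus\{+\}$, if $\star\in\Omega_2'$ then the operation $a\star^{\circ}b=b\star a$ is also in $\Omega_2'$; (c) for each $\star\in\Omega_2'$, $\mathsf{E}$ includes $a\star(b+c)=a\star b+a\star c$; (d) for $\omega\in\Omega_1'$, $\star\in\Omega_2'$, $\mathsf{E}$ includes $\omega(a+b)=\omega(a)+\omega(b)$ and $\omega(a)\star b=\omega(a\star b)$. Morphisms are group homomorphisms preserving all operations in $\Omega_1'$ and $\Omega_2'$. A subobject is a subset containing $0$ and closed under all operations. An ideal $N$ of $A$ is a subobject with $(N,+)$ normal in $(A,+)$ and $a\star n\in N$ for all $a\in A$, $n\in N$, $\star\in\Omega_2'$. Cat$^1$-groups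 with operations. A cat$^1$-group with operations is a triple $(G,s,t)$ with $G$ an object of $\mathsf{C}$ and $s,t$ endomorphisms of $G$ in $\mathsf{C}$ such that $st=t$, $ts=s$, elements of $\ker s$ and $\ker t$ commute under $+$, and $x\star y=0$ for $x\in\ker s$, $y\in\ker t$, $\star\in\Omega_2'$. A morphism $(G,s,t)\to(G',s',t')$ is a morphism $f\colon G\to G'$ in $\mathsf{C}$ with $fs=s'f$, $ft=t'f$; its kernel is $\ker f=\{g\in G\mid f(g)=0\}$ with the restrictions of $s$ and $t$. $(N,s_N,t_N)$ is a normal subcat$^1$-group with operations of $(G,s_G,t_G)$ if $N$ is an ideal of $G$ and $s_N,t_N$ are the restrictions of $s_G,t_G$ to $N$. *)

theory Defs
  imports "HOL-Algebra.Coset"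
begin

text \<open>
  The underlying (not necessarily commutative) group of an algebra is a group in the sense of
  HOL-Algebra, so the additive operations \<open>+\<close>, \<open>0\<close>, \<open>-\<close> of the mathematics are written
  \<open>\<otimes>\<close>, \<open>\<one>\<close>, \<open>inv\<close> here.  Symbols of \<open>'f\<close> name the unary operations other than \<open>-\<close>, and symbols of
  \<open>'g\<close> the binary operations other than \<open>+\<close>; only those in the operation sets of a theory count.
\<close>

datatype ('f, 'g) op_term =
    Var nat
  | Zero
  | Neg "('f, 'g) op_term"
  | Add "('f, 'g) op_term" "('f, 'g) op_term"
  | UnOp 'f "('f, 'g) op_term"
  | BinOp 'g "('f, 'g) op_term" "('f, 'g) op_term"

type_synonym ('f, 'g) identity = "('f, 'g) op_term \<times> ('f, 'g) op_term"

record ('f, 'g) op_theory =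
  unary_ops :: "'f set"
  binary_ops :: "'g set"
  identities :: "('f, 'g) identity set"

primrec wf_term :: "('f, 'g) op_theory \<Rightarrow> ('f, 'g) op_term \<Rightarrow> bool" where
  "wf_term T (Var i) \<longleftrightarrow> True"
| "wf_term T Zero \<longleftrightarrow> True"
| "wf_term T (Neg p) \<longleftrightarrow> wf_term T p"
| "wf_term T (Add p q) \<longleftrightarrow> wf_term T p \<and> wf_term T q"
| "wf_term T (UnOp w p) \<longleftrightarrow> w \<in> unary_ops T \<and> wf_term T p"
| "wf_term T (BinOp b p q) \<longleftrightarrow> b \<in> binary_ops T \<and> wf_term T p \<and> wf_term T q"

definition group_laws :: "('f, 'g) identity set" where
  "group_laws =
    {(Add (Add (Var 0) (Var 1)) (Var 2), Add (Var 0) (Add (Var 1) (Var 2))),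
     (Add Zero (Var 0), Var 0),
     (Add (Var 0) Zero, Var 0),
     (Add (Neg (Var 0)) (Var 0), Zero),
     (Add (Var 0) (Neg (Var 0)), Zero)}"

definition groups_with_operations :: "('f, 'g) op_theory \<Rightarrow> bool" where
  "groups_with_operations T \<longleftrightarrow>
     (\<forall>(p, q) \<in> identities T. wf_term T p \<and> wf_term T q) \<and>
     group_laws \<subseteq> identities T \<and>
     (\<forall>b \<in> binary_ops T. \<exists>b' \<in> binary_ops T.
        (BinOp b' (Var 0) (Var 1), BinOp b (Var 1) (Var 0)) \<in> identities T) \<and>
     (\<forall>b \<in> binary_ops T.
        (BinOp b (Var 0) (Add (Var 1) (Var 2)),
         Add (BinOp b (Var 0) (Var 1)) (BinOp b (Var 0) (Var 2))) \<in> identities T) \<and>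
     (\<forall>w \<in> unary_ops T.
        (UnOp w (Add (Var 0) (Var 1)), Add (UnOp w (Var 0)) (UnOp w (Var 1))) \<in> identities T) \<and>
     (\<forall>w \<in> unary_ops T. \<forall>b \<in> binary_ops T.
        (BinOp b (UnOp w (Var 0)) (Var 1), UnOp w (BinOp b (Var 0) (Var 1))) \<in> identities T)"

record ('a, 'f, 'g) op_group = "'a monoid" +
  unop :: "'f \<Rightarrow> 'a \<Rightarrow> 'a"
  binop :: "'g \<Rightarrow> 'a \<Rightarrow> 'a \<Rightarrow> 'a"

primrec term_val :: "('a, 'f, 'g) op_group \<Rightarrow> (nat \<Rightarrow> 'a) \<Rightarrow> ('f, 'g) op_term \<Rightarrow> 'a" where
  "term_val A e (Var i) = e i"
| "term_val A e Zero = \<one>\<^bsub>A\<^esub>"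
| "term_val A e (Neg p) = inv\<^bsub>A\<^esub> (term_val A e p)"
| "term_val A e (Add p q) = term_val A e p \<otimes>\<^bsub>A\<^esub> term_val A e q"
| "term_val A e (UnOp w p) = unop A w (term_val A e p)"
| "term_val A e (BinOp b p q) = binop A b (term_val A e p) (term_val A e q)"

definition satisfies :: "('a, 'f, 'g) op_group \<Rightarrow> ('f, 'g) identity \<Rightarrow> bool" where
  "satisfies A pq \<longleftrightarrow>
     (\<forall>e. (\<forall>i. e i \<in> carrier A) \<longrightarrow> term_val A e (fst pq) = term_val A e (snd pq))"

text \<open>
  Since the identities include the group laws, and \<open>-\<close> is then the inverse operation, asking for a
  HOL-Algebra group loses no objects.
\<close>

definition op_object :: "('f, 'g) op_theory \<Rightarrow> ('a, 'f, 'g) op_group \<Rightarrow> bool" where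
  "op_object T A \<longleftrightarrow>
     group A \<and>
     (\<forall>w \<in> unary_ops T. \<forall>x \<in> carrier A. unop A w x \<in> carrier A) \<and>
     (\<forall>b \<in> binary_ops T. \<forall>x \<in> carrier A. \<forall>y \<in> carrier A. binop A b x y \<in> carrier A) \<and>
     (\<forall>pq \<in> identities T. satisfies A pq)"

definition op_hom ::
    "('f, 'g) op_theory \<Rightarrow> ('a, 'f, 'g) op_group \<Rightarrow> ('b, 'f, 'g) op_group \<Rightarrow> ('a \<Rightarrow> 'b) set" where
  "op_hom T A B =
     {f \<in> hom A B.
        (\<forall>w \<in> unary_ops T. \<forall>x \<in> carrier A. f (unop A w x) = unop B w (f x)) \<and>
        (\<forall>b \<in> binary_ops T. \<forall>x \<in> carrier A. \<forall>y \<in> carrier A.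
           f (binop A b x y) = binop B b (f x) (f y))}"

definition op_subobject ::
    "('f, 'g) op_theory \<Rightarrow> ('a, 'f, 'g) op_group \<Rightarrow> 'a set \<Rightarrow> bool" where
  "op_subobject T A S \<longleftrightarrow>
     subgroup S A \<and>
     (\<forall>w \<in> unary_ops T. \<forall>x \<in> S. unop A w x \<in> S) \<and>
     (\<forall>b \<in> binary_ops T. \<forall>x \<in> S. \<forall>y \<in> S. binop A b x y \<in> S)"

definition op_ideal ::
    "('f, 'g) op_theory \<Rightarrow> ('a, 'f, 'g) op_group \<Rightarrow> 'a set \<Rightarrow> bool" where
  "op_ideal T A S \<longleftrightarrow>
     op_subobject T A S \<and> S \<lhd> A \<and>
     (\<forall>b \<in> binary_ops T. \<forall>a \<in> carrier A. \<forall>n \<in> S. binop A b a n \<in> S)"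

text \<open>
  An object \<open>N\<close> is a structure in its own right.  To identify it with a subset of \<open>G\<close> carrying the
  operations of \<open>G\<close>, its operations must agree with those of \<open>G\<close> on the carrier of \<open>N\<close>
  (the inverse then agrees automatically).
\<close>

definition induced_operations ::
    "('f, 'g) op_theory \<Rightarrow> ('a, 'f, 'g) op_group \<Rightarrow> ('a, 'f, 'g) op_group \<Rightarrow> bool" where
  "induced_operations T N G \<longleftrightarrow>
     carrier N \<subseteq> carrier G \<and> \<one>\<^bsub>N\<^esub> = \<one>\<^bsub>G\<^esub> \<and>
     (\<forall>x \<in> carrier N. \<forall>y \<in> carrier N. x \<otimes>\<^bsub>N\<^esub> y = x \<otimes>\<^bsub>G\<^esub> y) \<and>
     (\<forall>w \<in> unary_ops T. \<forall>x \<in> carrier N. unop N w x = unop G w x) \<and>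
     (\<forall>b \<in> binary_ops T. \<forall>x \<in> carrier N. \<forall>y \<in> carrier N. binop N b x y = binop G b x y)"

definition cat1_group ::
    "('f, 'g) op_theory \<Rightarrow> ('a, 'f, 'g) op_group \<Rightarrow> ('a \<Rightarrow> 'a) \<Rightarrow> ('a \<Rightarrow> 'a) \<Rightarrow> bool" where
  "cat1_group T G s t \<longleftrightarrow>
     op_object T G \<and> s \<in> op_hom T G G \<and> t \<in> op_hom T G G \<and>
     (\<forall>x \<in> carrier G. s (t x) = t x) \<and>
     (\<forall>x \<in> carrier G. t (s x) = s x) \<and>
     (\<forall>x \<in> kernel G G s. \<forall>y \<in> kernel G G t. x \<otimes>\<^bsub>G\<^esub> y = y \<otimes>\<^bsub>G\<^esub> x) \<and>
     (\<forall>b \<in> binary_ops T. \<forall>x \<in> kernel G G s. \<forall>y \<in> kernel G G t. binop G b x y = \<one>\<^bsub>G\<^esub>)"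

definition cat1_morphism ::
    "('f, 'g) op_theory \<Rightarrow>
     ('a, 'f, 'g) op_group \<Rightarrow> ('a \<Rightarrow> 'a) \<Rightarrow> ('a \<Rightarrow> 'a) \<Rightarrow>
     ('b, 'f, 'g) op_group \<Rightarrow> ('b \<Rightarrow> 'b) \<Rightarrow> ('b \<Rightarrow> 'b) \<Rightarrow> ('a \<Rightarrow> 'b) \<Rightarrow> bool" where
  "cat1_morphism T G s t H s' t' f \<longleftrightarrow>
     f \<in> op_hom T G H \<and>
     (\<forall>x \<in> carrier G. f (s x) = s' (f x)) \<and>
     (\<forall>x \<in> carrier G. f (t x) = t' (f x))"

definition is_cat1_kernel ::
    "('f, 'g) op_theory \<Rightarrow>
     ('a, 'f, 'g) op_group \<Rightarrow> ('a \<Rightarrow> 'a) \<Rightarrow> ('a \<Rightarrow> 'a) \<Rightarrow>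
     ('a, 'f, 'g) op_group \<Rightarrow> ('a \<Rightarrow> 'a) \<Rightarrow> ('a \<Rightarrow> 'a) \<Rightarrow>
     ('b, 'f, 'g) op_group \<Rightarrow> ('a \<Rightarrow> 'b) \<Rightarrow> bool" where
  "is_cat1_kernel T N s\<^sub>N t\<^sub>N G s\<^sub>G t\<^sub>G H f \<longleftrightarrow>
     carrier N = kernel G H f \<and> induced_operations T N G \<and>
     (\<forall>x \<in> carrier N. s\<^sub>N x = s\<^sub>G x) \<and> (\<forall>x \<in> carrier N. t\<^sub>N x = t\<^sub>G x)"

definition normal_subcat1_group ::
    "('f, 'g) op_theory \<Rightarrow>
     ('a, 'f, 'g) op_group \<Rightarrow> ('a \<Rightarrow> 'a) \<Rightarrow> ('a \<Rightarrow> 'a) \<Rightarrow>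
     ('a, 'f, 'g) op_group \<Rightarrow> ('a \<Rightarrow> 'a) \<Rightarrow> ('a \<Rightarrow> 'a) \<Rightarrow> bool" where
  "normal_subcat1_group T N s\<^sub>N t\<^sub>N G s\<^sub>G t\<^sub>G \<longleftrightarrow>
     op_ideal T G (carrier N) \<and> induced_operations T N G \<and>
     (\<forall>x \<in> carrier N. s\<^sub>N x = s\<^sub>G x) \<and> (\<forall>x \<in> carrier N. t\<^sub>N x = t\<^sub>G x)"

end

theory Submission imports Defs begin

text \<open>
  A kernel is a normal subobject because homomorphisms preserve every operation and, by
  distributivity, \<open>\<omega>(0) = 0\<close> and \<open>a \<star> 0 = 0\<close> (\<open>op_ideal_kernel\<close>).

  Conversely, a normal subcat1-group \<open>N\<close> is the kernel of the projection \<open>G \<rightarrow> G/N\<close>.  The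
  operations descend to \<open>G/N\<close> because \<open>N\<close> is an ideal (\<open>binop_in_coset\<close>, \<open>hom_in_coset\<close>).  That \<open>G/N\<close> is
  again a cat1-group is an instance of closure under surjective images
  (\<open>cat1_group_surjective_image\<close>).  All identities pass to surjective images.  The two conditions on
  \<open>ker s\<close> and \<open>ker t\<close> are not identities, but they pass as well: \<open>s\<close> is idempotent, so every \<open>x\<close>
  factors as \<open>(x - s x) + s x\<close> with \<open>x - s x\<close> in \<open>ker s\<close>; if \<open>f x\<close> lies in the kernel of the induced
  \<open>s'\<close>, then \<open>f (s x) = 0\<close>, so \<open>x - s x\<close> is a preimage of \<open>f x\<close> in \<open>ker s\<close>.  Hence the kernels of
  \<open>s'\<close> and \<open>t'\<close> are the images of \<open>ker s\<close> and \<open>ker t\<close>, and the conditions transfer from \<open>G\<close>.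

  The quotient has to live on the type of the elements of \<open>G\<close>, so it is built on a set of coset
  representatives instead of the set of cosets.
\<close>

section \<open>Consequences of the distributivity identities\<close>

lemma op_objectD:
  assumes "op_object T A"
  shows "group A"
    and "\<And>w x. w \<in> unary_ops T \<Longrightarrow> x \<in> carrier A \<Longrightarrow> unop A w x \<in> carrier A"
    and "\<And>b x y. b \<in> binary_ops T \<Longrightarrow> x \<in> carrier A \<Longrightarrow> y \<in> carrier A \<Longrightarrow> binop A b x y \<in> carrier A"
  using assms by (auto simp: op_object_def)

lemma op_homD:
  assumes "f \<in> op_hom T A B"
  shows "f \<in> hom A B"
    and "\<And>x. x \<in> carrier A \<Longrightarrow> f x \<in> carrier B"
    and "\<And>x y. x \<in> carrier A \<Longrightarrow> y \<in> carrier A \<Longrightarrow> f (x \<otimes>\<^bsub>A\<^esub> y) = f x \<otimes>\<^bsub>B\<^esub> f y"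
    and "\<And>w x. w \<in> unary_ops T \<Longrightarrow> x \<in> carrier A \<Longrightarrow> f (unop A w x) = unop B w (f x)"
    and "\<And>b x y. b \<in> binary_ops T \<Longrightarrow> x \<in> carrier A \<Longrightarrow> y \<in> carrier A \<Longrightarrow>
      f (binop A b x y) = binop B b (f x) (f y)"
  using assms by (auto simp: op_hom_def hom_def)

lemma op_hom_group_hom:
  assumes "op_object T A" "op_object T B" "f \<in> op_hom T A B"
  shows "group_hom A B f"
  using assms by (simp add: group_hom_def group_hom_axioms_def op_objectD(1) op_homD(1))

lemma op_object_identity:
  assumes "op_object T A" "(p, q) \<in> identities T" "\<And>i. e i \<in> carrier A"
  shows "term_val A e p = term_val A e q"
  using assms unfolding op_object_def satisfies_def by force

lemma unop_mult:
  assumes "groups_with_operations T" "op_object T A" "w \<in> unary_ops T"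
    and "x \<in> carrier A" "y \<in> carrier A"
  shows "unop A w (x \<otimes>\<^bsub>A\<^esub> y) = unop A w x \<otimes>\<^bsub>A\<^esub> unop A w y"
proof -
  have "(UnOp w (Add (Var 0) (Var 1)), Add (UnOp w (Var 0)) (UnOp w (Var 1))) \<in> identities T"
    using assms(1,3) unfolding groups_with_operations_def by blast
  from op_object_identity[OF assms(2) this, of "\<lambda>i. if i = 0 then x else y"] assms(4,5)
  show ?thesis by simp
qed

lemma binop_mult_right:
  assumes "groups_with_operations T" "op_object T A" "b \<in> binary_ops T"
    and "x \<in> carrier A" "y \<in> carrier A" "z \<in> carrier A"
  shows "binop A b x (y \<otimes>\<^bsub>A\<^esub> z) = binop A b x y \<otimes>\<^bsub>A\<^esub> binop A b x z"
proof -
  have "(BinOp b (Var 0) (Add (Var 1) (Var 2)),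
      Add (BinOp b (Var 0) (Var 1)) (BinOp b (Var 0) (Var 2))) \<in> identities T"
    using assms(1,3) unfolding groups_with_operations_def by blast
  from op_object_identity[OF assms(2) this, of "\<lambda>i. if i = 0 then x else if i = 1 then y else z"]
    assms(4-6)
  show ?thesis by simp
qed

lemma opposite_binop:
  assumes "groups_with_operations T" "op_object T A" "b \<in> binary_ops T"
  obtains b' where "b' \<in> binary_ops T"
    and "\<And>x y. x \<in> carrier A \<Longrightarrow> y \<in> carrier A \<Longrightarrow> binop A b' x y = binop A b y x"
proof -
  obtain b' where b': "b' \<in> binary_ops T"
    and id: "(BinOp b' (Var 0) (Var 1), BinOp b (Var 1) (Var 0)) \<in> identities T"
    using assms(1,3) unfolding groups_with_operations_def by blast
  show thesis
  proof (rule that[OF b'])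
    fix x y assume "x \<in> carrier A" "y \<in> carrier A"
    then show "binop A b' x y = binop A b y x"
      using op_object_identity[OF assms(2) id, of "\<lambda>i. if i = 0 then x else y"] by simp
  qed
qed

lemma binop_mult_left:
  assumes "groups_with_operations T" "op_object T A" "b \<in> binary_ops T"
    and "x \<in> carrier A" "y \<in> carrier A" "z \<in> carrier A"
  shows "binop A b (x \<otimes>\<^bsub>A\<^esub> y) z = binop A b x z \<otimes>\<^bsub>A\<^esub> binop A b y z"
proof -
  interpret group A using assms(2) by (rule op_objectD)
  obtain b' where b': "b' \<in> binary_ops T"
    and op: "\<And>x y. x \<in> carrier A \<Longrightarrow> y \<in> carrier A \<Longrightarrow> binop A b' x y = binop A b y x"
    using opposite_binop[OF assms(1-3)] by metis
  show ?thesis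
    using binop_mult_right[OF assms(1,2) b' assms(6,4,5)] assms(4-6) by (simp add: op)
qed

lemma unop_one:
  assumes "groups_with_operations T" "op_object T A" "w \<in> unary_ops T"
  shows "unop A w \<one>\<^bsub>A\<^esub> = \<one>\<^bsub>A\<^esub>"
proof -
  interpret group A using assms(2) by (rule op_objectD)
  have "unop A w \<one>\<^bsub>A\<^esub> \<otimes>\<^bsub>A\<^esub> unop A w \<one>\<^bsub>A\<^esub> = unop A w \<one>\<^bsub>A\<^esub>"
    using unop_mult[OF assms, of "\<one>\<^bsub>A\<^esub>" "\<one>\<^bsub>A\<^esub>"] by simp
  then show ?thesis using op_objectD(2)[OF assms(2,3)] by (simp add: l_cancel_one)
qed

lemma binop_one_right:
  assumes "groups_with_operations T" "op_object T A" "b \<in> binary_ops T" "x \<in> carrier A"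
  shows "binop A b x \<one>\<^bsub>A\<^esub> = \<one>\<^bsub>A\<^esub>"
proof -
  interpret group A using assms(2) by (rule op_objectD)
  have "binop A b x \<one>\<^bsub>A\<^esub> \<otimes>\<^bsub>A\<^esub> binop A b x \<one>\<^bsub>A\<^esub> = binop A b x \<one>\<^bsub>A\<^esub>"
    using binop_mult_right[OF assms, of "\<one>\<^bsub>A\<^esub>" "\<one>\<^bsub>A\<^esub>"] by simp
  then show ?thesis using op_objectD(3)[OF assms(2,3)] assms(4) by (simp add: l_cancel_one)
qed

section \<open>Kernels are ideals\<close>

lemma op_ideal_kernel:
  assumes T: "groups_with_operations T" and A: "op_object T A" and B: "op_object T B"
    and f: "f \<in> op_hom T A B"
  shows "op_ideal T A (kernel A B f)"
proof -
  interpret group_hom A B f using A B f by (rule op_hom_group_hom)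
  have binop: "binop A b a n \<in> kernel A B f"
    if "b \<in> binary_ops T" "a \<in> carrier A" "n \<in> kernel A B f" for b a n
    using that op_objectD(3)[OF A] op_homD(5)[OF f] binop_one_right[OF T B]
    by (auto simp: kernel_def)
  have unop: "unop A w n \<in> kernel A B f" if "w \<in> unary_ops T" "n \<in> kernel A B f" for w n
    using that op_objectD(2)[OF A] op_homD(4)[OF f] unop_one[OF T B]
    by (auto simp: kernel_def)
  have "kernel A B f \<subseteq> carrier A" by (auto simp: kernel_def)
  then show ?thesis
    unfolding op_ideal_def op_subobject_def
    using binop unop normal_kernel subgroup_kernel by blast
qed

section \<open>Surjective images\<close>

lemma term_val_closed:
  assumes "op_object T A" "wf_term T p" "\<And>i. e i \<in> carrier A"
  shows "term_val A e p \<in> carrier A"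
proof -
  interpret group A using assms(1) by (rule op_objectD)
  show ?thesis using assms(2) by (induction p) (auto simp: assms(3) op_objectD[OF assms(1)])
qed

lemma term_val_hom:
  assumes A: "op_object T A" and "group B" and f: "f \<in> op_hom T A B"
    and "wf_term T p" and e: "\<And>i. e i \<in> carrier A"
  shows "term_val B (\<lambda>i. f (e i)) p = f (term_val A e p)"
proof -
  interpret group_hom A B f
    using assms by (simp add: group_hom_def group_hom_axioms_def op_objectD(1) op_homD(1))
  show ?thesis
    using assms(4)
    by (induction p) (auto simp: term_val_closed[OF A _ e] op_homD(4,5)[OF f])
qed

text \<open>
  \<open>B\<close> is not known to be a group beforehand, so preservation of the unit does not follow from
  \<open>f\<close> being a homomorphism and is a hypothesis of its own.
\<close>

lemma op_object_surjective_image: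
  fixes A :: "('a, 'f, 'g) op_group" and B :: "('b, 'f, 'g) op_group"
  assumes T: "groups_with_operations T" and A: "op_object T A"
    and f: "f \<in> op_hom T A B" and surj: "f ` carrier A = carrier B" and one: "f \<one>\<^bsub>A\<^esub> = \<one>\<^bsub>B\<^esub>"
  shows "op_object T B"
proof -
  interpret A: group A using A by (rule op_objectD)
  have B: "group B"
    using A.hom_imp_img_group[OF op_homD(1)[OF f]] by (simp add: surj one)
  have "satisfies B (p, q)" if pq: "(p, q) \<in> identities T" for p q
    unfolding satisfies_def
  proof (intro allI impI)
    fix e :: "nat \<Rightarrow> 'b" assume "\<forall>i. e i \<in> carrier B"
    then have "\<forall>i. \<exists>x. x \<in> carrier A \<and> e i = f x" using surj by blast
    then obtain d where d: "\<And>i. d i \<in> carrier A" and e: "e = (\<lambda>i. f (d i))" by metis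
    have "wf_term T p" "wf_term T q"
      using T pq unfolding groups_with_operations_def by blast+
    then show "term_val B e (fst (p, q)) = term_val B e (snd (p, q))"
      using op_object_identity[OF A pq d] by (simp add: e term_val_hom[OF A B f _ d])
  qed
  moreover have "unop B w y \<in> carrier B" if "w \<in> unary_ops T" "y \<in> carrier B" for w y
    using that op_objectD(2)[OF A] op_homD(2)[OF f] by (auto simp: surj[symmetric] op_homD(4)[OF f, symmetric])
  moreover have "binop B b y z \<in> carrier B"
    if "b \<in> binary_ops T" "y \<in> carrier B" "z \<in> carrier B" for b y z
    using that op_objectD(3)[OF A] op_homD(2)[OF f] by (auto simp: surj[symmetric] op_homD(5)[OF f, symmetric])
  ultimately show ?thesis using B unfolding op_object_def by auto
qed

lemma induced_endomorphism:
  assumes A: "op_object T A" and f: "f \<in> op_hom T A B" and surj: "f ` carrier A = carrier B"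
    and s: "s \<in> op_hom T A A" and comm: "\<And>x. x \<in> carrier A \<Longrightarrow> s' (f x) = f (s x)"
  shows "s' \<in> op_hom T B B"
proof -
  interpret group A using A by (rule op_objectD)
  note s' = op_homD[OF s] and f' = op_homD[OF f] and A' = op_objectD(2,3)[OF A]
  have "s' y \<in> carrier B" if "y \<in> carrier B" for y
    using that by (auto simp: surj[symmetric] comm s')
  moreover have "s' (y \<otimes>\<^bsub>B\<^esub> z) = s' y \<otimes>\<^bsub>B\<^esub> s' z" if "y \<in> carrier B" "z \<in> carrier B" for y z
    using that by (auto simp: surj[symmetric] comm s' f'(2) f'(3)[symmetric])
  moreover have "s' (unop B w y) = unop B w (s' y)" if "w \<in> unary_ops T" "y \<in> carrier B" for w y
    using that by (auto simp: surj[symmetric] comm s' A' f'(2) f'(4)[symmetric])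
  moreover have "s' (binop B b y z) = binop B b (s' y) (s' z)"
    if "b \<in> binary_ops T" "y \<in> carrier B" "z \<in> carrier B" for b y z
    using that by (auto simp: surj[symmetric] comm s' A' f'(2) f'(5)[symmetric])
  ultimately show ?thesis by (auto simp: op_hom_def hom_def)
qed

text \<open>
  Idempotence of \<open>s\<close> is essential: it makes \<open>x - s x\<close> an element of \<open>ker s\<close>, and this element has
  the same image as \<open>x\<close> as soon as \<open>s' (f x) = 0\<close>.
\<close>

lemma kernel_element_lifts:
  assumes "group_hom A B f" "s \<in> hom A A"
    and idem: "\<And>x. x \<in> carrier A \<Longrightarrow> s (s x) = s x"
    and surj: "f ` carrier A = carrier B"
    and comm: "\<And>x. x \<in> carrier A \<Longrightarrow> s' (f x) = f (s x)"
    and y: "y \<in> kernel B B s'"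
  obtains x where "x \<in> kernel A A s" "f x = y"
proof -
  interpret group_hom A B f by fact
  interpret s: group_hom A A s
    using assms(2) by unfold_locales
  obtain x where x: "x \<in> carrier A" "y = f x" and "s' y = \<one>\<^bsub>B\<^esub>"
    using y surj unfolding kernel_def by blast
  then have "f (s x) = \<one>\<^bsub>B\<^esub>" by (simp add: comm)
  with x have "x \<otimes>\<^bsub>A\<^esub> inv\<^bsub>A\<^esub> (s x) \<in> kernel A A s" "f (x \<otimes>\<^bsub>A\<^esub> inv\<^bsub>A\<^esub> (s x)) = y"
    by (auto simp: kernel_def idem)
  then show thesis by (rule that)
qed

lemma cat1_group_surjective_image:
  assumes T: "groups_with_operations T" and A: "cat1_group T A s t"
    and f: "f \<in> op_hom T A B" and surj: "f ` carrier A = carrier B" and one: "f \<one>\<^bsub>A\<^esub> = \<one>\<^bsub>B\<^esub>"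
    and s': "\<And>x. x \<in> carrier A \<Longrightarrow> s' (f x) = f (s x)"
    and t': "\<And>x. x \<in> carrier A \<Longrightarrow> t' (f x) = f (t x)"
  shows "cat1_group T B s' t'"
proof -
  have obj: "op_object T A" and s: "s \<in> op_hom T A A" and t: "t \<in> op_hom T A A"
    and st: "\<And>x. x \<in> carrier A \<Longrightarrow> s (t x) = t x"
    and ts: "\<And>x. x \<in> carrier A \<Longrightarrow> t (s x) = s x"
    and commute: "\<And>x y. x \<in> kernel A A s \<Longrightarrow> y \<in> kernel A A t \<Longrightarrow> x \<otimes>\<^bsub>A\<^esub> y = y \<otimes>\<^bsub>A\<^esub> x"
    and annihilate: "\<And>b x y. b \<in> binary_ops T \<Longrightarrow> x \<in> kernel A A s \<Longrightarrow> y \<in> kernel A A t \<Longrightarrow>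
      binop A b x y = \<one>\<^bsub>A\<^esub>"
    using A unfolding cat1_group_def by blast+
  have B: "op_object T B" using T obj f surj one by (rule op_object_surjective_image)
  have hom: "group_hom A B f" using obj B f by (rule op_hom_group_hom)
  \<comment> \<open>From \<open>ts = s\<close> and \<open>st = t\<close>: \<open>ss = s(ts) = (st)s = ts = s\<close>.\<close>
  have ss: "s (s x) = s x" and tt: "t (t x) = t x" if "x \<in> carrier A" for x
    using that st[of "s x"] ts[of x] ts[of "t x"] st[of x] op_homD(2)[OF s] op_homD(2)[OF t] by auto
  have lift: "\<exists>x z. x \<in> kernel A A s \<and> z \<in> kernel A A t \<and> f x = u \<and> f z = v"
    if "u \<in> kernel B B s'" "v \<in> kernel B B t'" for u v
    using kernel_element_lifts[OF hom op_homD(1)[OF s] ss surj s' that(1)]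
      kernel_element_lifts[OF hom op_homD(1)[OF t] tt surj t' that(2)] by metis
  have "s' (t' y) = t' y" "t' (s' y) = s' y" if "y \<in> carrier B" for y
    using that by (auto simp: surj[symmetric] s' t' st ts op_homD(2)[OF s] op_homD(2)[OF t])
  moreover have "u \<otimes>\<^bsub>B\<^esub> v = v \<otimes>\<^bsub>B\<^esub> u" if uv: "u \<in> kernel B B s'" "v \<in> kernel B B t'" for u v
  proof -
    obtain x z where "x \<in> kernel A A s" "z \<in> kernel A A t" "f x = u" "f z = v"
      using lift[OF uv] by blast
    then show ?thesis
      using commute[of x z] op_homD(3)[OF f, of x z] op_homD(3)[OF f, of z x]
      by (auto simp: kernel_def)
  qed
  moreover have "binop B b u v = \<one>\<^bsub>B\<^esub>"
    if b: "b \<in> binary_ops T" and uv: "u \<in> kernel B B s'" "v \<in> kernel B B t'" for b u v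
  proof -
    obtain x z where "x \<in> kernel A A s" "z \<in> kernel A A t" "f x = u" "f z = v"
      using lift[OF uv] by blast
    then show ?thesis
      using annihilate[OF b, of x z] op_homD(5)[OF f b, of x z] one by (auto simp: kernel_def)
  qed
  ultimately show ?thesis
    unfolding cat1_group_def
    using B induced_endomorphism[OF obj f surj s s'] induced_endomorphism[OF obj f surj t t']
    by blast
qed

section \<open>The quotient by an ideal\<close>

definition coset_rep :: "('a, 'm) monoid_scheme \<Rightarrow> 'a set \<Rightarrow> 'a \<Rightarrow> 'a" where
  "coset_rep G N x = (SOME y. y \<in> N #>\<^bsub>G\<^esub> x)"

definition quotient ::
    "('a, 'f, 'g) op_group \<Rightarrow> 'a set \<Rightarrow> ('a, 'f, 'g) op_group" where
  "quotient G N =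
     \<lparr>carrier = coset_rep G N ` carrier G,
      mult = \<lambda>x y. coset_rep G N (x \<otimes>\<^bsub>G\<^esub> y),
      one = coset_rep G N \<one>\<^bsub>G\<^esub>,
      unop = \<lambda>w x. coset_rep G N (unop G w x),
      binop = \<lambda>b x y. coset_rep G N (binop G b x y)\<rparr>"

context
  fixes G (structure) and N
  assumes N: "N \<lhd> G"
begin

interpretation normal N G by (rule N)

lemma coset_rep_in_coset: "x \<in> carrier G \<Longrightarrow> coset_rep G N x \<in> N #> x"
  unfolding coset_rep_def by (rule someI) (rule rcos_self[OF _ subgroup_axioms])

lemma coset_rep_closed: "x \<in> carrier G \<Longrightarrow> coset_rep G N x \<in> carrier G"
  using coset_rep_in_coset r_coset_subset_G[OF subset] by blast

lemma coset_rep_cong: "x \<in> carrier G \<Longrightarrow> y \<in> N #> x \<Longrightarrow> coset_rep G N y = coset_rep G N x"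
  unfolding coset_rep_def by (simp add: repr_independence[OF _ _ subgroup_axioms, symmetric])

lemma coset_rep_cong_mult:
  assumes "x \<in> carrier G" "y \<in> carrier G" "x' \<in> N #> x" "y' \<in> N #> y"
  shows "coset_rep G N (x' \<otimes> y') = coset_rep G N (x \<otimes> y)"
proof -
  have "x' \<otimes> y' \<in> (N #> x) <#> (N #> y)"
    using assms(3,4) by (auto simp: set_mult_def)
  then show ?thesis using assms(1,2) by (intro coset_rep_cong) (simp_all add: rcos_sum)
qed

lemma coset_rep_eq_one_iff:
  assumes "x \<in> carrier G"
  shows "coset_rep G N x = coset_rep G N \<one> \<longleftrightarrow> x \<in> N"
proof
  assume "coset_rep G N x = coset_rep G N \<one>"
  then have z: "coset_rep G N x \<in> N #> x" "coset_rep G N x \<in> N"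
    using coset_rep_in_coset[OF assms] coset_rep_in_coset[OF one_closed]
    by (simp_all add: coset_mult_one[OF subset])
  have "N #> x = N #> coset_rep G N x"
    using repr_independence[OF z(1) assms subgroup_axioms] .
  also have "\<dots> = N"
    using coset_join2[OF coset_rep_closed[OF assms] subgroup_axioms z(2)] .
  finally show "x \<in> N"
    using coset_join1 assms subgroup_axioms by blast
next
  assume "x \<in> N"
  then show "coset_rep G N x = coset_rep G N \<one>"
    by (intro coset_rep_cong) (simp_all add: coset_mult_one[OF subset])
qed

end

text \<open>
  The binary operations descend to cosets because \<open>(n + x) \<star> (m + y)\<close> differs from \<open>x \<star> y\<close> by
  elements of the forms \<open>a \<star> m\<close> and \<open>n \<star> y\<close>.  The first lies in \<open>N\<close> by the definition of an ideal,
  the second because \<open>n \<star> y = y \<star>\<degree> n\<close> for the opposite operation.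
\<close>

lemma binop_in_coset:
  assumes T: "groups_with_operations T" and G: "op_object T G" and N: "op_ideal T G N"
    and b: "b \<in> binary_ops T" and x: "x \<in> carrier G" and y: "y \<in> carrier G"
    and x': "x' \<in> N #>\<^bsub>G\<^esub> x" and y': "y' \<in> N #>\<^bsub>G\<^esub> y"
  shows "binop G b x' y' \<in> N #>\<^bsub>G\<^esub> binop G b x y"
proof -
  interpret normal N G using N by (simp add: op_ideal_def)
  have absorb: "binop G b a n \<in> N" if "b \<in> binary_ops T" "a \<in> carrier G" "n \<in> N" for b a n
    using N that by (simp add: op_ideal_def)
  note closed = op_objectD(3)[OF G]
  obtain n m where n: "n \<in> N" "x' = n \<otimes>\<^bsub>G\<^esub> x" and m: "m \<in> N" "y' = m \<otimes>\<^bsub>G\<^esub> y"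
    using x' y' by (auto simp: r_coset_def)
  have car: "n \<in> carrier G" "m \<in> carrier G" "x' \<in> carrier G"
    using n m x by (simp_all add: mem_carrier)
  obtain b' where "b' \<in> binary_ops T"
    "\<And>x y. x \<in> carrier G \<Longrightarrow> y \<in> carrier G \<Longrightarrow> binop G b' x y = binop G b y x"
    using opposite_binop[OF T G b] by metis
  with absorb[of b' y n] have left: "binop G b n y \<in> N" using n(1) car(1) y by simp
  have right: "binop G b x' m \<in> N" using absorb[OF b car(3) m(1)] .
  have "binop G b x' y' = binop G b x' m \<otimes>\<^bsub>G\<^esub> binop G b x' y"
    using binop_mult_right[OF T G b car(3,2) y] m(2) by simp
  also have "binop G b x' y = binop G b n y \<otimes>\<^bsub>G\<^esub> binop G b x y"
    using binop_mult_left[OF T G b car(1) x y] n(2) by simp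
  finally have "binop G b x' y' = (binop G b x' m \<otimes>\<^bsub>G\<^esub> binop G b n y) \<otimes>\<^bsub>G\<^esub> binop G b x y"
    using left right closed[OF b x y] by (simp add: m_assoc mem_carrier)
  moreover have "binop G b x' m \<otimes>\<^bsub>G\<^esub> binop G b n y \<in> N" using left right by blast
  ultimately show ?thesis by (auto simp: r_coset_def)
qed

text \<open>
  This serves two purposes: by distributivity the unary operations are endomorphisms of the additive
  group, so it makes them descend to cosets, and it does the same for \<open>s\<close> and \<open>t\<close>.
\<close>

lemma hom_in_coset:
  assumes "group_hom G G s" "N \<lhd> G" "\<And>n. n \<in> N \<Longrightarrow> s n \<in> N" "x \<in> carrier G" "x' \<in> N #>\<^bsub>G\<^esub> x"
  shows "s x' \<in> N #>\<^bsub>G\<^esub> s x"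
proof -
  interpret group_hom G G s by fact
  interpret normal N G by fact
  obtain n where "n \<in> N" "x' = n \<otimes>\<^bsub>G\<^esub> x" using assms(5) by (auto simp: r_coset_def)
  then have "s x' = s n \<otimes>\<^bsub>G\<^esub> s x" "s n \<in> N" using assms(3,4) by (simp_all add: mem_carrier)
  then show ?thesis by (auto simp: r_coset_def)
qed

lemma coset_rep_op_hom:
  assumes T: "groups_with_operations T" and G: "op_object T G" and N: "op_ideal T G N"
  shows "coset_rep G N \<in> op_hom T G (quotient G N)"
proof -
  have normal: "N \<lhd> G" using N by (simp add: op_ideal_def)
  interpret normal N G by (rule normal)
  note rep = coset_rep_in_coset[OF normal]
  have "coset_rep G N (x \<otimes>\<^bsub>G\<^esub> y) = coset_rep G N (coset_rep G N x \<otimes>\<^bsub>G\<^esub> coset_rep G N y)"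
    if "x \<in> carrier G" "y \<in> carrier G" for x y
    using coset_rep_cong_mult[OF normal that rep rep] that by simp
  moreover have "coset_rep G N (unop G w x) = coset_rep G N (unop G w (coset_rep G N x))"
    if w: "w \<in> unary_ops T" and x: "x \<in> carrier G" for w x
  proof -
    have hom: "group_hom G G (unop G w)"
      using unop_mult[OF T G w] op_objectD(2)[OF G w] by unfold_locales (auto simp: hom_def)
    have "\<And>n. n \<in> N \<Longrightarrow> unop G w n \<in> N"
      using N w by (simp add: op_ideal_def op_subobject_def)
    from hom_in_coset[OF hom normal this x rep[OF x]]
    show ?thesis using coset_rep_cong[OF normal] op_objectD(2)[OF G w x] by simp
  qed
  moreover have "coset_rep G N (binop G b x y) =
      coset_rep G N (binop G b (coset_rep G N x) (coset_rep G N y))"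
    if b: "b \<in> binary_ops T" and xy: "x \<in> carrier G" "y \<in> carrier G" for b x y
    using coset_rep_cong[OF normal op_objectD(3)[OF G b xy]
        binop_in_coset[OF T G N b xy rep[OF xy(1)] rep[OF xy(2)]]] by simp
  ultimately show ?thesis by (simp add: op_hom_def hom_def quotient_def)
qed

text \<open>
  Stability of \<open>N\<close> under \<open>s\<close> and \<open>t\<close> is what lets them descend to cosets; the cat1-conditions for
  the descended maps are then those of a surjective image.
\<close>

lemma cat1_quotient:
  assumes T: "groups_with_operations T" and G: "cat1_group T G s t" and N: "op_ideal T G N"
    and sN: "\<And>n. n \<in> N \<Longrightarrow> s n \<in> N" and tN: "\<And>n. n \<in> N \<Longrightarrow> t n \<in> N"
  defines "r \<equiv> coset_rep G N" and "H \<equiv> quotient G N"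
  shows "cat1_group T H (\<lambda>x. r (s x)) (\<lambda>x. r (t x))"
    and "cat1_morphism T G s t H (\<lambda>x. r (s x)) (\<lambda>x. r (t x)) r"
    and "kernel G H r = N"
proof -
  have obj: "op_object T G" and s: "s \<in> op_hom T G G" and t: "t \<in> op_hom T G G"
    using G unfolding cat1_group_def by blast+
  have normal: "N \<lhd> G" using N by (simp add: op_ideal_def)
  have r: "r \<in> op_hom T G H" unfolding r_def H_def using T obj N by (rule coset_rep_op_hom)
  have surj: "r ` carrier G = carrier H" and one: "r \<one>\<^bsub>G\<^esub> = \<one>\<^bsub>H\<^esub>"
    by (simp_all add: r_def H_def quotient_def)
  have descends: "r (h (r x)) = r (h x)"
    if h: "h \<in> op_hom T G G" and hN: "\<And>n. n \<in> N \<Longrightarrow> h n \<in> N" and x: "x \<in> carrier G" for h x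
    unfolding r_def
    using coset_rep_cong[OF normal op_homD(2)[OF h x]
        hom_in_coset[OF op_hom_group_hom[OF obj obj h] normal hN x coset_rep_in_coset[OF normal x]]] .
  show "cat1_group T H (\<lambda>x. r (s x)) (\<lambda>x. r (t x))"
    using T G r surj one by (rule cat1_group_surjective_image) (simp_all add: descends s t sN tN)
  show "cat1_morphism T G s t H (\<lambda>x. r (s x)) (\<lambda>x. r (t x)) r"
    using r by (simp add: cat1_morphism_def descends s t sN tN)
  show "kernel G H r = N"
    using coset_rep_eq_one_iff[OF normal] normal_imp_subgroup[OF normal, THEN subgroup.subset]
    by (auto simp: kernel_def r_def H_def quotient_def)
qed

section \<open>Normal subcat1-groups are kernels\<close>

lemma cat1_kernel_normal:
  assumes T: "groups_with_operations T" and "cat1_group T G s t" "cat1_group T H s' t'"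
    and "cat1_morphism T G s t H s' t' f" and ker: "is_cat1_kernel T N s\<^sub>N t\<^sub>N G s t H f"
  shows "normal_subcat1_group T N s\<^sub>N t\<^sub>N G s t"
proof -
  have "op_ideal T G (kernel G H f)"
    using assms(2-4) unfolding cat1_group_def cat1_morphism_def
    by (intro op_ideal_kernel[OF T]) auto
  then show ?thesis using ker by (simp add: is_cat1_kernel_def normal_subcat1_group_def)
qed

lemma normal_subcat1_group_is_kernel:
  fixes G N :: "('a, 'f, 'g) op_group"
  assumes T: "groups_with_operations T" and G: "cat1_group T G s t"
    and N: "cat1_group T N s\<^sub>N t\<^sub>N" and normal: "normal_subcat1_group T N s\<^sub>N t\<^sub>N G s t"
  shows "\<exists>(H :: ('a, 'f, 'g) op_group) s' t' f. cat1_group T H s' t' \<and>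
    cat1_morphism T G s t H s' t' f \<and> is_cat1_kernel T N s\<^sub>N t\<^sub>N G s t H f"
proof -
  have ideal: "op_ideal T G (carrier N)"
    and sN: "\<And>n. n \<in> carrier N \<Longrightarrow> s\<^sub>N n = s n" and tN: "\<And>n. n \<in> carrier N \<Longrightarrow> t\<^sub>N n = t n"
    using normal by (simp_all add: normal_subcat1_group_def)
  \<comment> \<open>As endomorphisms of \<open>N\<close>, the restrictions of \<open>s\<close> and \<open>t\<close> map \<open>N\<close> into itself.\<close>
  have "s\<^sub>N \<in> op_hom T N N" "t\<^sub>N \<in> op_hom T N N" using N by (simp_all add: cat1_group_def)
  then have "\<And>n. n \<in> carrier N \<Longrightarrow> s n \<in> carrier N" "\<And>n. n \<in> carrier N \<Longrightarrow> t n \<in> carrier N"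
    using op_homD(2) sN tN by metis+
  note quotient = cat1_quotient[OF T G ideal this]
  moreover have "is_cat1_kernel T N s\<^sub>N t\<^sub>N G s t (quotient G (carrier N)) (coset_rep G (carrier N))"
    using normal quotient(3) by (simp add: is_cat1_kernel_def normal_subcat1_group_def)
  ultimately show ?thesis by blast
qed

theorem theorem6p10:
  fixes T :: "('f, 'g) op_theory"
    and G N :: "('a, 'f, 'g) op_group"
    and s\<^sub>G t\<^sub>G s\<^sub>N t\<^sub>N :: "'a \<Rightarrow> 'a"
  assumes "groups_with_operations T"
    and "cat1_group T G s\<^sub>G t\<^sub>G"
    and "cat1_group T N s\<^sub>N t\<^sub>N"
  shows "(normal_subcat1_group T N s\<^sub>N t\<^sub>N G s\<^sub>G t\<^sub>G \<longleftrightarrow>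
           (\<exists>(H :: ('a, 'f, 'g) op_group) s\<^sub>H t\<^sub>H f.
              cat1_group T H s\<^sub>H t\<^sub>H \<and>
              cat1_morphism T G s\<^sub>G t\<^sub>G H s\<^sub>H t\<^sub>H f \<and>
              is_cat1_kernel T N s\<^sub>N t\<^sub>N G s\<^sub>G t\<^sub>G H f)) \<and>
         (\<forall>(H :: ('b, 'f, 'g) op_group) s\<^sub>H t\<^sub>H f.
              cat1_group T H s\<^sub>H t\<^sub>H \<and>
              cat1_morphism T G s\<^sub>G t\<^sub>G H s\<^sub>H t\<^sub>H f \<and>
              is_cat1_kernel T N s\<^sub>N t\<^sub>N G s\<^sub>G t\<^sub>G H f \<longrightarrow>
              normal_subcat1_group T N s\<^sub>N t\<^sub>N G s\<^sub>G t\<^sub>G)"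
  by (blast intro: normal_subcat1_group_is_kernel[OF assms] cat1_kernel_normal[OF assms(1,2)])

end
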